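(* Suppose $$p(z)=\prod_{k=1}^{m}(z-x_k)\prod_{k=1}^{n}\left[(z-a_k)^2+b_k^2\right],$$ where $x_k\ge 0$, $a_k>0$, and $b_k>0$ for all $k$. For fixed real numbers $\alpha,\beta,\lambda$ with $0\le\alpha\le\pi$, define $$f(z)=e^{i\lambda}p(e^{i\alpha}z)+e^{i\beta}p(e^{-i\alpha}z).$$ Then every non-real zero of $f$ must lie in at least one Jensen sector-disc $\Delta(a_k,b_k;\alpha)$.
   Context: Jensen sector-disc: let $a,b$ be positive real numbers, let $\theta=\arg(a+ib)$, and let $0\le\alpha\le\pi$. If $|\sec\alpha|<\sec\theta$, then $\Delta(a,b;\alpha)\subset\mathbb{C}$ is the closed disc with center $c=(\cos\alpha)\,(a^2+b^2)/a=a\cos\alpha\sec^2\theta$ and radius $r=\sqrt{c^2-a^2-b^2}$. If $|\sec\alpha|$ is not less than $\sec\theta$, then $\Delta(a,b;\alpha)=\emptyset$. The discs in the claim are those attached to the non-real zeros $a_k\pm ib_k$ of $p$; the polynomial $p$ is allowed to have no non-real zeros ($n=0$).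
   Formalization: The formal theorem additionally assumes that f is not identically zero; without this the claim fails, e.g. for p = 1, λ = 0, β = π, where f vanishes everywhere and there are no discs. *)

theory Defs
  imports "HOL-Analysis.Analysis"
begin

(* The secant is written out as 1 / cos.  The guard cos alpha \<noteq> 0 covers
   alpha = pi/2, where |sec alpha| is infinite and the disc is empty, whereas
   1 / cos alpha would evaluate to 0. *)
definition jensen_sector_disc :: "real \<Rightarrow> real \<Rightarrow> real \<Rightarrow> complex set" where
  "jensen_sector_disc a b \<alpha> =
    (let \<theta> = Arg (Complex a b);
         c = cos \<alpha> * (a\<^sup>2 + b\<^sup>2) / a;
         r = sqrt (c\<^sup>2 - a\<^sup>2 - b\<^sup>2)
     in if cos \<alpha> \<noteq> 0 \<and> \<bar>1 / cos \<alpha>\<bar> < 1 / cos \<theta> then cball (complex_of_real c) r else {})"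

end

theory Submission
  imports Defs
begin

text \<open>
  A zero \<open>z\<close> of \<open>f\<close> satisfies \<open>\<bar>p(uz)\<bar> = \<bar>p(vz)\<bar>\<close> with \<open>u = e\<^sup>i\<^sup>\<alpha>\<close> and \<open>v\<close> its conjugate.
  If \<open>sin \<alpha>\<close> and \<open>Im z\<close> are positive, every real factor of \<open>p\<close> is at least as large in modulus
  at \<open>uz\<close> as at \<open>vz\<close>, and for a quadratic factor the difference of the squared moduli is
  \<open>8 a sin \<alpha> Im z (\<bar>z - c\<bar>\<^sup>2 - r\<^sup>2)\<close>, which is positive outside the Jensen sector-disc.
  The case \<open>Im z < 0\<close> exchanges \<open>u\<close> and \<open>v\<close>. What remains is \<open>p = z\<^sup>m\<close>, where a nonzero \<open>f\<close>
  vanishes only at \<open>0\<close>, and \<open>sin \<alpha> = 0\<close>, where \<open>uz\<close> is itself a zero of \<open>p\<close>.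
\<close>

text \<open>The guard amounts to \<open>s < c\<^sup>2\<close>, positivity of the radicand of
  \<open>r\<close>. For non-real \<open>z\<close> this follows from |z - c|^2 \<le> r^2, since |z -
  c|^2 > 0. What remains is a (|z - c|^2 - r^2) \<le> 0, cleared of its denominator.\<close>

lemma mem_jensen_sector_disc_iff:
  assumes a: "a > 0" and b: "b > 0" and z: "Im z \<noteq> 0"
  shows "z \<in> jensen_sector_disc a b \<alpha> \<longleftrightarrow>
    a * ((cmod z)\<^sup>2 + (a\<^sup>2 + b\<^sup>2)) \<le> 2 * (a\<^sup>2 + b\<^sup>2) * cos \<alpha> * Re z"
proof -
  define s where "s = a\<^sup>2 + b\<^sup>2"
  define c where "c = cos \<alpha> * s / a"
  have s: "s > 0" using a by (simp add: s_def add_pos_nonneg)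
  have "cos (Arg (Complex a b)) = a / sqrt s"
    using a by (subst cos_Arg) (auto simp: s_def cmod_def complex_eq_iff)
  then have "cos \<alpha> \<noteq> 0 \<and> \<bar>1 / cos \<alpha>\<bar> < 1 / cos (Arg (Complex a b)) \<longleftrightarrow>
      cos \<alpha> \<noteq> 0 \<and> a < sqrt s * \<bar>cos \<alpha>\<bar>"
    using a by (auto simp: field_simps abs_divide)
  \<comment> \<open>At cos \<alpha> = 0 the inequality would read a < 0, so it already implies the
    other conjunct.\<close>
  also have "\<dots> \<longleftrightarrow> a < sqrt s * \<bar>cos \<alpha>\<bar>"
    using a by auto
  also have "\<dots> \<longleftrightarrow> \<bar>a\<bar> < \<bar>sqrt s * cos \<alpha>\<bar>"
    using a s by (simp add: abs_mult)
  also have "\<dots> \<longleftrightarrow> a\<^sup>2 < (sqrt s * cos \<alpha>)\<^sup>2"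
    using abs_le_square_iff[of "sqrt s * cos \<alpha>" a] by (simp only: not_le[symmetric])
  also have "\<dots> \<longleftrightarrow> a\<^sup>2 < s * (cos \<alpha>)\<^sup>2"
    using s by (simp add: power_mult_distrib)
  also have "\<dots> \<longleftrightarrow> s * a\<^sup>2 < s * (s * (cos \<alpha>)\<^sup>2)"
    using s by simp
  also have "\<dots> \<longleftrightarrow> s < c\<^sup>2"
    using a by (simp add: c_def field_simps power2_eq_square)
  finally have guard: "cos \<alpha> \<noteq> 0 \<and> \<bar>1 / cos \<alpha>\<bar> < 1 / cos (Arg (Complex a b)) \<longleftrightarrow> s < c\<^sup>2" .
  have dist: "(dist (complex_of_real c) z)\<^sup>2 = (cmod z)\<^sup>2 - 2 * c * Re z + c\<^sup>2"
    by (simp add: dist_norm cmod_power2) (simp add: power2_eq_square algebra_simps)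
  have imp: "s < c\<^sup>2" if "(cmod z)\<^sup>2 - 2 * c * Re z + s \<le> 0"
  proof -
    have "(cmod z)\<^sup>2 - 2 * c * Re z + c\<^sup>2 = (Re z - c)\<^sup>2 + (Im z)\<^sup>2"
      by (simp add: cmod_power2) (simp add: power2_eq_square algebra_simps)
    moreover have "(Re z - c)\<^sup>2 + (Im z)\<^sup>2 > 0"
      using z by (simp add: add_nonneg_pos)
    ultimately show ?thesis using that by linarith
  qed
  have "z \<in> jensen_sector_disc a b \<alpha> \<longleftrightarrow>
      s < c\<^sup>2 \<and> dist (complex_of_real c) z \<le> sqrt (c\<^sup>2 - s)"
    unfolding jensen_sector_disc_def Let_def using guard by (simp add: c_def s_def diff_diff_eq)
  also have "\<dots> \<longleftrightarrow> s < c\<^sup>2 \<and> (dist (complex_of_real c) z)\<^sup>2 \<le> c\<^sup>2 - s"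
    by (metis real_sqrt_abs real_sqrt_le_iff abs_of_nonneg zero_le_dist)
  also have "\<dots> \<longleftrightarrow> (cmod z)\<^sup>2 - 2 * c * Re z + s \<le> 0"
    using imp dist by auto
  also have "\<dots> \<longleftrightarrow> a * ((cmod z)\<^sup>2 - 2 * c * Re z + s) \<le> 0"
    using a by (simp add: mult_le_0_iff)
  also have "a * ((cmod z)\<^sup>2 - 2 * c * Re z + s) = a * ((cmod z)\<^sup>2 + s) - 2 * s * cos \<alpha> * Re z"
    using a by (simp add: c_def field_simps)
  finally show ?thesis by (simp add: s_def)
qed

text \<open>The points \<open>u * z\<close> and \<open>cnj u * z\<close> have equal modulus, and the
  real part of the second exceeds that of the first by 2 Im u Im z.\<close>

lemma cmod_linear_factor_rotate:
  "(cmod (u * z - of_real x))\<^sup>2 - (cmod (cnj u * z - of_real x))\<^sup>2 = 4 * x * (Im u * Im z)"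
  by (simp add: cmod_power2) (simp add: power2_eq_square algebra_simps)

lemma cmod_quadratic_factor_rotate:
  assumes u: "cmod u = 1"
  shows "(cmod ((u * z - of_real a)\<^sup>2 + (of_real b)\<^sup>2))\<^sup>2
       - (cmod ((cnj u * z - of_real a)\<^sup>2 + (of_real b)\<^sup>2))\<^sup>2
    = 8 * (Im u * Im z) * (a * ((cmod z)\<^sup>2 + (a\<^sup>2 + b\<^sup>2)) - 2 * (a\<^sup>2 + b\<^sup>2) * Re u * Re z)"
proof -
  \<comment> \<open>Written in |w| and Re w, only the terms in Re w and its square survive the
    subtraction. The two real parts have sum 2 Re u Re z and differ by 2 Im u Im z, which yields the
    two factors of the claim.\<close>
  have q: "(cmod ((w - of_real a)\<^sup>2 + (of_real b)\<^sup>2))\<^sup>2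
      = ((cmod w)\<^sup>2)\<^sup>2 + 4 * a\<^sup>2 * (cmod w)\<^sup>2 + (a\<^sup>2 + b\<^sup>2)\<^sup>2
        + 2 * (a\<^sup>2 + b\<^sup>2) * (2 * (Re w)\<^sup>2 - (cmod w)\<^sup>2)
        - 4 * a * ((cmod w)\<^sup>2 + (a\<^sup>2 + b\<^sup>2)) * Re w" for w
    by (simp add: cmod_power2) (simp add: power2_eq_square algebra_simps)
  have "cmod (u * z) = cmod z" "cmod (cnj u * z) = cmod z"
    using u by (simp_all add: norm_mult)
  then show ?thesis
    unfolding q by (simp add: power2_eq_square algebra_simps)
qed

text \<open>The sign condition is on the product Im u Im z, so that \<open>cnj u\<close> can take
  the place of \<open>u\<close> in the lower half-plane.\<close>

lemma linear_factor_mono: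
  assumes "Im u * Im z > 0" "x \<ge> 0"
  shows "cmod (cnj u * z - of_real x) \<le> cmod (u * z - of_real x)"
proof (rule power2_le_imp_le)
  have "4 * x * (Im u * Im z) \<ge> 0" using assms by simp
  then show "(cmod (cnj u * z - of_real x))\<^sup>2 \<le> (cmod (u * z - of_real x))\<^sup>2"
    using cmod_linear_factor_rotate[of u z x] by linarith
qed simp

lemma linear_factor_strict_mono:
  assumes "Im u * Im z > 0" "x > 0"
  shows "cmod (cnj u * z - of_real x) < cmod (u * z - of_real x)"
proof (rule power2_less_imp_less)
  have "4 * x * (Im u * Im z) > 0" using assms by simp
  then show "(cmod (cnj u * z - of_real x))\<^sup>2 < (cmod (u * z - of_real x))\<^sup>2"
    using cmod_linear_factor_rotate[of u z x] by linarith
qed simp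

lemma quadratic_factor_strict_mono:
  assumes "cmod u = 1" "Im u * Im z > 0" "Re u = cos \<alpha>" "a > 0" "b > 0"
    and "z \<notin> jensen_sector_disc a b \<alpha>"
  shows "cmod ((cnj u * z - of_real a)\<^sup>2 + (of_real b)\<^sup>2)
    < cmod ((u * z - of_real a)\<^sup>2 + (of_real b)\<^sup>2)"
proof (rule power2_less_imp_less)
  have "Im z \<noteq> 0" using assms(2) by auto
  then have "a * ((cmod z)\<^sup>2 + (a\<^sup>2 + b\<^sup>2)) - 2 * (a\<^sup>2 + b\<^sup>2) * Re u * Re z > 0"
    using mem_jensen_sector_disc_iff[of a b z \<alpha>] assms by auto
  then have "8 * (Im u * Im z)
      * (a * ((cmod z)\<^sup>2 + (a\<^sup>2 + b\<^sup>2)) - 2 * (a\<^sup>2 + b\<^sup>2) * Re u * Re z) > 0"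
    using assms(2) by simp
  then show "(cmod ((cnj u * z - of_real a)\<^sup>2 + (of_real b)\<^sup>2))\<^sup>2
      < (cmod ((u * z - of_real a)\<^sup>2 + (of_real b)\<^sup>2))\<^sup>2"
    using cmod_quadratic_factor_rotate[OF assms(1), of z a b] by linarith
qed simp

text \<open>One strict factor makes the product strict because all factors at \<open>u * z\<close>
  are positive. The condition \<open>nontriv\<close> excludes P(w) = w^j, whose moduli at the two
  points agree.\<close>

lemma prod_factors_strict_mono:
  fixes x a b :: "nat \<Rightarrow> real"
  assumes "finite K" "finite L"
    and u: "cmod u = 1" "Im u * Im z > 0" "Re u = cos \<alpha>"
    and x: "\<And>k. k \<in> K \<Longrightarrow> x k \<ge> 0"
    and ab: "\<And>k. k \<in> L \<Longrightarrow> a k > 0" "\<And>k. k \<in> L \<Longrightarrow> b k > 0"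
    and out: "\<And>k. k \<in> L \<Longrightarrow> z \<notin> jensen_sector_disc (a k) (b k) \<alpha>"
    and nontriv: "L \<noteq> {} \<or> (\<exists>k\<in>K. x k > 0)"
  defines "P \<equiv> \<lambda>w. (\<Prod>k\<in>K. w - of_real (x k)) *
      (\<Prod>k\<in>L. (w - of_real (a k))\<^sup>2 + (of_real (b k))\<^sup>2)"
  shows "cmod (P (cnj u * z)) < cmod (P (u * z))"
proof -
  define f where "f w k = cmod (w - of_real (x k))" for w k
  define g where "g w k = cmod ((w - of_real (a k))\<^sup>2 + (of_real (b k))\<^sup>2)" for w k
  have cmod_P: "cmod (P w) = prod (f w) K * prod (g w) L" for w
    by (simp add: P_def f_def g_def norm_mult prod_norm)
  have uz: "u * z \<noteq> 0" using u by auto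
  have f_le: "f (cnj u * z) k \<le> f (u * z) k" if "k \<in> K" for k
    using linear_factor_mono[OF u(2) x[OF that]] by (simp add: f_def)
  have f_less: "f (cnj u * z) k < f (u * z) k" if "x k > 0" for k
    using linear_factor_strict_mono[OF u(2) that] by (simp add: f_def)
  have f_nonneg: "f w k \<ge> 0" and g_nonneg: "g w k \<ge> 0" for w k
    by (simp_all add: f_def g_def)
  \<comment> \<open>A root at 0 gives no strict inequality, but its factor is \<open>u * z\<close>
    itself, which is nonzero.\<close>
  have f_pos: "f (u * z) k > 0" if "k \<in> K" for k
  proof (cases "x k = 0")
    case True
    then show ?thesis using uz by (simp add: f_def)
  next
    case False
    then have "x k > 0" using x[OF that] by simp
    then show ?thesis using f_less[of k] f_nonneg[of "cnj u * z" k] by linarith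
  qed
  have g_less: "g (cnj u * z) k < g (u * z) k" if "k \<in> L" for k
    using quadratic_factor_strict_mono[OF u ab(1)[OF that] ab(2)[OF that] out[OF that]]
    by (simp add: g_def)
  have g_pos: "g (u * z) k > 0" if "k \<in> L" for k
    using g_less[OF that] g_nonneg[of "cnj u * z" k] by linarith
  have F_le: "prod (f (cnj u * z)) K \<le> prod (f (u * z)) K"
    by (intro prod_mono) (auto simp: f_le f_nonneg)
  have G_le: "prod (g (cnj u * z)) L \<le> prod (g (u * z)) L"
    by (intro prod_mono) (auto simp: g_less g_nonneg less_imp_le)
  have F_pos: "prod (f (u * z)) K > 0" and G_pos: "prod (g (u * z)) L > 0"
    by (auto intro!: prod_pos f_pos g_pos)
  have F_nonneg: "prod (f (cnj u * z)) K \<ge> 0" and G_nonneg: "prod (g (cnj u * z)) L \<ge> 0"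
    by (auto intro!: prod_nonneg f_nonneg g_nonneg)
  from nontriv show ?thesis
  proof
    assume "L \<noteq> {}"
    then obtain l where "l \<in> L" by auto
    then have "prod (g (cnj u * z)) L < prod (g (u * z)) L"
      using \<open>finite L\<close>
      by (intro prod_mono_strict[of l]) (auto simp: g_less g_nonneg g_pos less_imp_le)
    \<comment> \<open>With F, G the two products at \<open>u * z\<close> and F', G' those at
      \<open>cnj u * z\<close>, the chain is F' G' \<le> F G' < F G. The strict step multiplies by F
      > 0, as G' may vanish.\<close>
    then show ?thesis
      unfolding cmod_P using F_le F_pos G_nonneg
      by (intro le_less_trans[OF mult_right_mono mult_strict_left_mono])
  next
    assume "\<exists>k\<in>K. x k > 0"
    then obtain l where "l \<in> K" "x l > 0" by auto
    then have "prod (f (cnj u * z)) K < prod (f (u * z)) K"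
      using \<open>finite K\<close>
      by (intro prod_mono_strict[of l]) (auto simp: f_less f_le f_nonneg f_pos)
    then show ?thesis
      unfolding cmod_P using G_le G_pos F_nonneg
      by (intro le_less_trans[OF mult_left_mono mult_strict_right_mono])
  qed
qed

text \<open>Here cos \<alpha> is 1 or -1, so cos \<alpha> Re z = a and |z|^2 = a^2 + b^2. The
  membership criterion then holds with equality: \<open>z\<close> is on the boundary circle.\<close>

lemma quadratic_factor_zero_in_disc:
  assumes "sin \<alpha> = 0" "a > 0" "b > 0" "Im z \<noteq> 0"
    and zero: "(of_real (cos \<alpha>) * z - of_real a)\<^sup>2 + (of_real b)\<^sup>2 = 0"
  shows "z \<in> jensen_sector_disc a b \<alpha>"
proof -
  define w where "w = of_real (cos \<alpha>) * z"
  have cos1: "(cos \<alpha>)\<^sup>2 = 1" using sin_cos_squared_add[of \<alpha>] assms(1) by simp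
  have "(w - of_real a)\<^sup>2 = (\<i> * of_real b)\<^sup>2"
    using zero by (simp add: w_def power_mult_distrib eq_neg_iff_add_eq_0)
  then have "w - of_real a = \<i> * of_real b \<or> w - of_real a = - (\<i> * of_real b)"
    by (simp only: power2_eq_iff)
  then have w: "w = of_real a + \<i> * of_real b \<or> w = of_real a - \<i> * of_real b"
    by (auto simp: algebra_simps)
  then have "(cmod w)\<^sup>2 = a\<^sup>2 + b\<^sup>2" by (auto simp: cmod_power2)
  moreover have "(cmod w)\<^sup>2 = (cmod z)\<^sup>2"
    using cos1 by (simp add: w_def norm_mult power_mult_distrib)
  moreover have "cos \<alpha> * Re z = a" using w by (auto simp: w_def complex_eq_iff)
  ultimately show ?thesis
    using assms by (subst mem_jensen_sector_disc_iff) (auto simp: algebra_simps)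
qed

theorem theorem2p2:
  fixes m n :: nat
    and x a b :: "nat \<Rightarrow> real"
    and p f :: "complex \<Rightarrow> complex"
    and \<alpha> \<beta> lam :: real
  assumes x_nonneg: "\<And>k. k \<in> {1..m} \<Longrightarrow> x k \<ge> 0"
    and a_pos: "\<And>k. k \<in> {1..n} \<Longrightarrow> a k > 0"
    and b_pos: "\<And>k. k \<in> {1..n} \<Longrightarrow> b k > 0"
    and p_eq: "\<And>z. p z = (\<Prod>k=1..m. z - of_real (x k)) *
                 (\<Prod>k=1..n. (z - of_real (a k))\<^sup>2 + (of_real (b k))\<^sup>2)"
    and alpha: "0 \<le> \<alpha>" "\<alpha> \<le> pi"
    and f_eq: "\<And>z. f z = exp (\<i> * of_real lam) * p (exp (\<i> * of_real \<alpha>) * z)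
                      + exp (\<i> * of_real \<beta>) * p (exp (- \<i> * of_real \<alpha>) * z)"
    and f_nonzero: "\<exists>w. f w \<noteq> 0"
  shows "\<forall>z. f z = 0 \<and> z \<notin> \<real> \<longrightarrow> (\<exists>k\<in>{1..n}. z \<in> jensen_sector_disc (a k) (b k) \<alpha>)"
proof (intro allI impI)
  fix z assume "f z = 0 \<and> z \<notin> \<real>"
  then have fz: "f z = 0" and z: "Im z \<noteq> 0" by (auto simp: complex_is_Real_iff)
  define u where "u = cis \<alpha>"
  have u: "cmod u = 1" "Re u = cos \<alpha>" "Im u = sin \<alpha>" by (simp_all add: u_def)
  have f: "f w = cis lam * p (u * w) + cis \<beta> * p (cnj u * w)" for w
    using cis_conv_exp[of "- \<alpha>"] by (simp add: f_eq u_def cis_cnj flip: cis_conv_exp)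
  have "cis lam * p (u * z) = - (cis \<beta> * p (cnj u * z))"
    using fz by (simp add: f eq_neg_iff_add_eq_0)
  then have "cmod (cis lam * p (u * z)) = cmod (cis \<beta> * p (cnj u * z))"
    by simp
  then have norm_eq: "cmod (p (u * z)) = cmod (p (cnj u * z))"
    by (simp add: norm_mult)
  show "\<exists>k\<in>{1..n}. z \<in> jensen_sector_disc (a k) (b k) \<alpha>"
  proof (rule ccontr)
    assume "\<not> ?thesis"
    then have out: "z \<notin> jensen_sector_disc (a k) (b k) \<alpha>" if "k \<in> {1..n}" for k
      using that by auto
    consider (sin0) "sin \<alpha> = 0" | (power) "n = 0" "\<forall>k\<in>{1..m}. x k = 0"
      | (strict) "sin \<alpha> > 0" "{1..n} \<noteq> {} \<or> (\<exists>k\<in>{1..m}. x k > 0)"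
    proof -
      have "\<forall>k\<in>{1..m}. x k = 0 \<or> x k > 0" using x_nonneg by fastforce
      moreover have "sin \<alpha> = 0 \<or> sin \<alpha> > 0" using sin_ge_zero[OF alpha] by linarith
      moreover have "n = 0 \<or> {1..n} \<noteq> {}" by auto
      ultimately show ?thesis using that by blast
    qed
    then show False
    proof cases
      case sin0
      have u_real: "u = of_real (cos \<alpha>)" "cnj u = of_real (cos \<alpha>)"
        using sin0 u by (simp_all add: complex_eq_iff)
      have f': "f w = (cis lam + cis \<beta>) * p (of_real (cos \<alpha>) * w)" for w
        by (simp add: f u_real algebra_simps)
      \<comment> \<open>Otherwise \<open>f\<close> would vanish identically.\<close>
      have "cis lam + cis \<beta> \<noteq> 0" using f_nonzero by (auto simp: f')
      then have "p (of_real (cos \<alpha>) * z) = 0" using fz by (simp add: f')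
      \<comment> \<open>As cos \<alpha> is 1 or -1, the rotated point is still non-real, so the zero
        comes from a quadratic factor.\<close>
      moreover have "of_real (cos \<alpha>) * z - of_real (x k) \<noteq> 0" for k
        using z sin0 sin_cos_squared_add[of \<alpha>] by (auto simp: complex_eq_iff)
      ultimately obtain k where "k \<in> {1..n}"
        "(of_real (cos \<alpha>) * z - of_real (a k))\<^sup>2 + (of_real (b k))\<^sup>2 = 0"
        unfolding p_eq by auto
      then show False
        using quadratic_factor_zero_in_disc[OF sin0 a_pos b_pos z] out by blast
    next
      case power
      then have "p w = w ^ m" for w by (simp add: p_eq)
      then have f': "f w = (cis lam * u ^ m + cis \<beta> * cnj u ^ m) * w ^ m" for w
        by (simp add: f power_mult_distrib algebra_simps)
      have "z \<noteq> 0" using z by auto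
      \<comment> \<open>A constant multiple of w^m with a zero at \<open>z\<close> \<noteq> 0 has
        constant 0, hence is identically zero.\<close>
      then have "cis lam * u ^ m + cis \<beta> * cnj u ^ m = 0" using fz by (simp add: f')
      then show False using f_nonzero by (simp add: f')
    next
      case strict
      \<comment> \<open>The rotation stays open, to be filled by \<open>u\<close> or
        \<open>cnj u\<close> according to the sign of Im z.\<close>
      note mono = prod_factors_strict_mono[of "{1..m}" "{1..n}" _ z \<alpha> x a b,
          OF finite_atLeastAtMost finite_atLeastAtMost _ _ _ x_nonneg a_pos b_pos out strict(2),
          folded p_eq]
      show False
      proof (cases "Im z > 0")
        case True
        then show False using mono[of u] strict(1) u norm_eq by simp
      next
        case False
        \<comment> \<open>Both factors are negative. Exchanging \<open>u\<close> and
          \<open>cnj u\<close> reverses the strict inequality, which contradicts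
          \<open>norm_eq\<close> as well.\<close>
        then have "Im (cnj u) * Im z > 0"
          using z strict(1) u by (simp add: mult_pos_neg)
        then show False using mono[of "cnj u"] u norm_eq by simp
      qed
    qed
  qed
qed

end
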